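(* Let $r\in\mathbb{R}$ and $0\le a<b$. Let $g:[a,b]\to(0,\infty)$ be an $r$-convex function on $[a,b]$ and let $f:[a,b]\to(0,\infty)$ be $(g,r)$-convex dominated on $[a,b]$. If $f\in L_1[a,b]$, then $$\left|L_r(f(a),f(b))-\frac{1}{b-a}\int_a^b f(x)\,dx\right|\le L_r(g(a),g(b))-\frac{1}{b-a}\int_a^b g(x)\,dx.$$
   Context: For $x,y>0$, $\lambda\in[0,1]$ and $r\in\mathbb{R}$, the power mean of order $r$ is $M_r(x,y;\lambda)=(\lambda x^r+(1-\lambda)y^r)^{1/r}$ if $r\ne0$, and $M_0(x,y;\lambda)=x^\lambda y^{1-\lambda}$. A positive function $g$ on $[a,b]$ is $r$-convex if $g(\lambda x+(1-\lambda)y)\le M_r(g(x),g(y);\lambda)$ for all $x,y\in[a,b]$, $\lambda\in[0,1]$. Given a positive $r$-convex function $g$ on $[a,b]$, a function $f$ on $[a,b]$ is called $(g,r)$-convex dominated on $[a,b]$ if $$\left|M_r(f(x),f(y);\lambda)-f(\lambda x+(1-\lambda)y)\right|\le M_r(g(x),g(y);\lambda)-g(\lambda x+(1-\lambda)y)$$ for all $x,y\in[a,b]$ and $\lambda\in[0,1]$. The generalized logarithmic mean of order $r$ of $x,y>0$ is $$L_r(x,y)=\begin{cases}\dfrac{r}{r+1}\,\dfrac{x^{r+1}-y^{r+1}}{x^r-y^r}, & r\ne0,-1,\ x\ne y,\\[2mm] \dfrac{x-y}{\ln x-\ln y}, & r=0,\ x\ne y,\\[2mm] xy\,\dfrac{\ln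 x-\ln y}{x-y}, & r=-1,\ x\ne y,\\[2mm] x, & x=y.\end{cases}$$ $L_1[a,b]$ denotes the Lebesgue integrable functions on $[a,b]$. *)

theory Defs
  imports "HOL-Analysis.Analysis"
begin

definition power_mean :: "real \<Rightarrow> real \<Rightarrow> real \<Rightarrow> real \<Rightarrow> real" where
  "power_mean r x y t =
     (if r = 0 then x powr t * y powr (1 - t)
      else (t * x powr r + (1 - t) * y powr r) powr (1 / r))"

definition r_convex_on :: "real \<Rightarrow> real \<Rightarrow> real \<Rightarrow> (real \<Rightarrow> real) \<Rightarrow> bool" where
  "r_convex_on r a b g \<longleftrightarrow>
     (\<forall>x\<in>{a..b}. 0 < g x) \<and>
     (\<forall>x\<in>{a..b}. \<forall>y\<in>{a..b}. \<forall>t\<in>{0..1}.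
        g (t * x + (1 - t) * y) \<le> power_mean r (g x) (g y) t)"

text \<open>Positivity of the dominated function is not part of this definition. It must be assumed
  separately, since \<^const>\<open>power_mean\<close> agrees with the power mean only for positive arguments.\<close>

definition convex_dominated_on ::
    "(real \<Rightarrow> real) \<Rightarrow> real \<Rightarrow> real \<Rightarrow> real \<Rightarrow> (real \<Rightarrow> real) \<Rightarrow> bool" where
  "convex_dominated_on g r a b f \<longleftrightarrow>
     r_convex_on r a b g \<and>
     (\<forall>x\<in>{a..b}. \<forall>y\<in>{a..b}. \<forall>t\<in>{0..1}.
        \<bar>power_mean r (f x) (f y) t - f (t * x + (1 - t) * y)\<bar>
          \<le> power_mean r (g x) (g y) t - g (t * x + (1 - t) * y))"

definition log_mean :: "real \<Rightarrow> real \<Rightarrow> real \<Rightarrow> real" where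
  "log_mean r x y =
     (if x = y then x
      else if r = 0 then (x - y) / (ln x - ln y)
      else if r = -1 then x * y * ((ln x - ln y) / (x - y))
      else r / (r + 1) * ((x powr (r + 1) - y powr (r + 1)) / (x powr r - y powr r)))"

end

theory Submission imports Defs begin

text \<open>
  The generalized logarithmic mean is the average of the power means over all weights:
  \<open>L\<^sub>r(x, y)\<close> is the integral of \<open>t \<mapsto> M\<^sub>r(x, y; t)\<close> over \<open>[0, 1]\<close>
  (lemma \<open>has_integral_power_mean\<close>). So, writing \<open>z \<in> [a, b]\<close> as \<open>t a + (1 - t) b\<close>, the
  right-hand side of the claim is the average over \<open>[a, b]\<close> of the Jensen gap
  \<open>M\<^sub>r(h(a), h(b); t) - h(z)\<close> for \<open>h = g\<close>, and the left-hand side is the absolute value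
  of this average for \<open>h = f\<close>. Domination,
  applied to the two end points only, says that the gap of \<open>f\<close> is bounded in absolute value by
  the gap of \<open>g\<close> at every \<open>z\<close>, and the integral preserves this bound.

  The average of \<open>g\<close> is meaningful only if \<open>g\<close> is integrable, which has to be derived from
  \<open>r\<close>-convexity (lemma \<open>r_convex_on_set_integrable\<close>). As a power mean never exceeds
  the larger of its arguments, an \<open>r\<close>-convex function is quasiconvex, whatever \<open>r\<close> is. Its sublevel sets are
  therefore intervals, so it is Borel measurable, and it is bounded by the larger of its values
  at the end points.
\<close>

lemma power_mean_same:
  assumes "x > 0"
  shows "power_mean r x x t = x"
  using assms by (simp add: power_mean_def powr_powr flip: powr_add distrib_right)

lemma convex_combination_pos:
  fixes u v t :: real
  assumes "u > 0" "v > 0" "t \<in> {0..1}"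
  shows "t * u + (1 - t) * v > 0"
  using assms convex_bound_lt[of "-u" 0 "-v" t "1 - t"] by simp

text \<open>For \<open>r < 0\<close> the inner and the outer power are both decreasing, so their composition is again
  increasing in each argument.\<close>

lemma power_mean_mono:
  assumes "0 < x" "x \<le> x'" "0 < y" "y \<le> y'" and t: "t \<in> {0..1}"
  shows "power_mean r x y t \<le> power_mean r x' y' t"
proof -
  consider "r = 0" | "r > 0" | "r < 0" by linarith
  then show ?thesis
  proof cases
    case 1
    then show ?thesis
      using assms by (auto simp: power_mean_def intro!: mult_mono powr_mono2)
  next
    case 2
    have "t * x powr r + (1 - t) * y powr r \<le> t * x' powr r + (1 - t) * y' powr r"
      using assms 2 by (intro add_mono mult_left_mono powr_mono2) auto
    moreover have "0 < t * x powr r + (1 - t) * y powr r"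
      using assms by (intro convex_combination_pos) auto
    ultimately show ?thesis
      using 2 by (auto simp: power_mean_def intro!: powr_mono2)
  next
    case 3
    have "t * x' powr r + (1 - t) * y' powr r \<le> t * x powr r + (1 - t) * y powr r"
      using assms 3 by (intro add_mono mult_left_mono powr_mono2') auto
    moreover have "0 < t * x' powr r + (1 - t) * y' powr r"
      using assms by (intro convex_combination_pos) auto
    ultimately show ?thesis
      using 3 by (auto simp: power_mean_def intro!: powr_mono2')
  qed
qed

lemma power_mean_le_max:
  assumes "0 < x" "0 < y" "t \<in> {0..1}"
  shows "power_mean r x y t \<le> max x y"
  using power_mean_mono[of x "max x y" y "max x y" t r] power_mean_same[of "max x y" r t] assms
  by simp

text \<open>In each case of the definition of the logarithmic mean, an explicit antiderivative in the
  weight \<open>t\<close> is available. For \<open>r \<noteq> 0\<close> the power mean is a power of the affine function \<open>w\<close>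
  running from \<open>y\<^sup>r\<close> to \<open>x\<^sup>r\<close>; its exponent \<open>1 / r\<close> equals \<open>-1\<close> exactly when
  \<open>r = -1\<close>, which is why the logarithm appears there.\<close>

lemma has_integral_power_mean:
  assumes x: "x > 0" and y: "y > 0"
  shows "(power_mean r x y has_integral log_mean r x y) {0..1}"
proof -
  have FTC: "(power_mean r x y has_integral F 1 - F 0) {0..1}"
    if "\<And>t. t \<in> {0..1} \<Longrightarrow> (F has_real_derivative power_mean r x y t) (at t)" for F
    using that by (intro fundamental_theorem_of_calculus)
      (auto intro: DERIV_subset simp flip: has_real_derivative_iff_has_vector_derivative)
  define w where "w t = t * x powr r + (1 - t) * y powr r" for t
  define d where "d = x powr r - y powr r"
  have w_pos: "w t > 0" if "t \<in> {0..1}" for t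
    unfolding w_def using x y that by (intro convex_combination_pos) auto
  have w_deriv: "(w has_real_derivative d) (at t)" for t
    unfolding w_def d_def by (auto intro!: derivative_eq_intros)
  have w_ends: "w 0 = y powr r" "w 1 = x powr r"
    by (simp_all add: w_def)
  have d_nz: "d \<noteq> 0" if "x \<noteq> y" "r \<noteq> 0"
  proof
    assume "d = 0"
    then have "(x powr r) powr (1 / r) = (y powr r) powr (1 / r)" by (simp add: d_def)
    then show False using that x y by (simp add: powr_powr)
  qed
  consider "x = y" | "x \<noteq> y" "r = 0" | "x \<noteq> y" "r = -1" | "x \<noteq> y" "r \<noteq> 0" "r \<noteq> -1"
    by blast
  then show ?thesis
  proof cases
    case 1
    have "((\<lambda>t. t * x) has_real_derivative power_mean r x y t) (at t)" for t
      using 1 x by (auto simp: power_mean_same intro!: derivative_eq_intros)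
    from FTC[OF this] show ?thesis using 1 by (simp add: log_mean_def)
  next
    case 2
    have nz: "ln x - ln y \<noteq> 0" using 2 x y by simp
    have "((\<lambda>t. x powr t * y powr (1 - t) / (ln x - ln y)) has_real_derivative
            power_mean r x y t) (at t)" for t
    proof -
      have "((\<lambda>t. x powr t * y powr (1 - t)) has_real_derivative
              x powr t * y powr (1 - t) * (ln x - ln y)) (at t)"
        using x y by (auto intro!: derivative_eq_intros simp: algebra_simps)
      from DERIV_cdivide[OF this, of "ln x - ln y"] show ?thesis
        using nz \<open>r = 0\<close> by (simp add: power_mean_def)
    qed
    from FTC[OF this] show ?thesis
      using 2 x y by (simp add: log_mean_def diff_divide_distrib)
  next
    case 3
    have "((\<lambda>t. ln (w t) / d) has_real_derivative power_mean r x y t) (at t)"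
      if "t \<in> {0..1}" for t
    proof -
      have "((\<lambda>t. ln (w t)) has_real_derivative w t powr (1 / r) * d) (at t)"
        using DERIV_chain2[OF DERIV_ln_divide[OF w_pos[OF that]] w_deriv] w_pos[OF that] 3
        by (simp add: powr_minus_divide)
      from DERIV_cdivide[OF this, of d] show ?thesis
        using d_nz 3 by (simp add: power_mean_def w_def)
    qed
    from FTC[OF this] have "(power_mean r x y has_integral (ln (x powr r) - ln (y powr r)) / d) {0..1}"
      by (simp add: w_ends diff_divide_distrib)
    also have "(ln (x powr r) - ln (y powr r)) / d = log_mean r x y"
      using 3 x y by (simp add: log_mean_def d_def powr_minus_divide ln_div divide_simps)
         (simp add: algebra_simps)
    finally show ?thesis .
  next
    case 4
    have nz: "r + 1 \<noteq> 0" "d \<noteq> 0" using 4 d_nz by auto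
    have "((\<lambda>t. r / (r + 1) * (w t powr ((r + 1) / r) / d)) has_real_derivative power_mean r x y t) (at t)"
      if "t \<in> {0..1}" for t
    proof -
      have e: "(r + 1) / r - 1 = 1 / r" using 4 by (simp add: field_simps)
      have "((\<lambda>t. w t powr ((r + 1) / r)) has_real_derivative
              ((r + 1) / r * w t powr (1 / r)) * d) (at t)"
        using DERIV_chain2[OF has_real_derivative_powr[OF w_pos[OF that], of "(r + 1) / r"] w_deriv]
        unfolding e .
      from DERIV_cmult[OF DERIV_cdivide[OF this, of d], of "r / (r + 1)"]
      show ?thesis using nz 4 by (simp add: power_mean_def w_def)
    qed
    from FTC[OF this] show ?thesis
      using 4 by (simp add: w_ends powr_powr log_mean_def d_def diff_divide_distrib right_diff_distrib)
  qed
qed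

text \<open>The substitution \<open>t = (b - z) / (b - a)\<close>, which reverses orientation: the weight \<open>t\<close>
  belongs to the end point \<open>a\<close>, hence equals \<open>1\<close> there.\<close>

lemma has_integral_power_mean_Icc:
  assumes "a < b" "x > 0" "y > 0"
  shows "((\<lambda>z. power_mean r x y ((b - z) / (b - a))) has_integral (b - a) * log_mean r x y) {a..b}"
proof -
  define m where "m = - 1 / (b - a)"
  have m: "m \<noteq> 0" "1 / m = a - b" "1 / \<bar>m\<bar> = b - a" "(a - b) * (b / (b - a)) = - b"
    using assms(1) by (auto simp: m_def field_simps)
  have "(\<lambda>z. (1 / m) *\<^sub>R z + - ((1 / m) *\<^sub>R (b / (b - a)))) ` {0..1} = {a..b}"
    unfolding m(2) real_scaleR_def m(4)
    using assms(1) image_affinity_atLeastAtMost[of "a - b" b 0 "1::real"] by simp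
  moreover have "m *\<^sub>R z + b / (b - a) = (b - z) / (b - a)" for z
    by (simp add: m_def diff_divide_distrib)
  ultimately show ?thesis
    using has_integral_affinity[of "power_mean r x y" _ 0 1 m "b / (b - a)"]
      has_integral_power_mean[OF assms(2,3), of r] m(1,3)
    by simp
qed

lemma borel_measurable_quasiconvex:
  fixes g :: "real \<Rightarrow> real"
  assumes "is_interval S" and "\<And>c. is_interval {x \<in> S. g x \<le> c}"
  shows "g \<in> borel_measurable (restrict_space borel S)"
  using assms
  by (intro borel_measurableI_le)
     (auto simp: space_restrict_space sets_restrict_space_iff real_interval_borel_measurable)

text \<open>Quasiconvexity: the consequence of \<open>r\<close>-convexity that does not depend on \<open>r\<close>.\<close>

lemma r_convex_on_le_max:
  assumes "r_convex_on r a b g" "x \<in> {a..b}" "y \<in> {a..b}" "t \<in> {0..1}"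
  shows "g (t * x + (1 - t) * y) \<le> max (g x) (g y)"
  using assms power_mean_le_max[of "g x" "g y" t r] unfolding r_convex_on_def by fastforce

lemma convex_combination_Icc:
  fixes a b z :: real
  assumes "a < b" "z \<in> {a..b}"
  defines "t \<equiv> (b - z) / (b - a)"
  shows "t \<in> {0..1}" "t * a + (1 - t) * b = z"
proof -
  show "t \<in> {0..1}" using assms by (simp add: t_def)
  have "t * (b - a) = b - z" using assms by (simp add: t_def)
  then show "t * a + (1 - t) * b = z" by (simp add: algebra_simps)
qed

text \<open>Measurability through sublevel sets avoids treating the orders \<open>r > 0\<close>, \<open>r = 0\<close> and
  \<open>r < 0\<close> separately, where convexity of \<open>g\<^sup>r\<close>, convexity of \<open>ln g\<close> and concavity of
  \<open>g\<^sup>r\<close> would respectively yield continuity in the interior.\<close>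

lemma r_convex_on_set_integrable:
  assumes "a < b" and g: "r_convex_on r a b g"
  shows "set_integrable lebesgue {a..b} g"
proof -
  have conv: "convex {x \<in> {a..b}. g x \<le> c}" for c
  proof (rule convexI)
    fix x y u v :: real
    assume xy: "x \<in> {x \<in> {a..b}. g x \<le> c}" "y \<in> {x \<in> {a..b}. g x \<le> c}"
      and uv: "0 \<le> u" "0 \<le> v" "u + v = 1"
    have "u *\<^sub>R x + v *\<^sub>R y \<in> {a..b}"
      using convexD[OF convex_real_interval(5)[of a b]] xy uv by blast
    moreover have "v = 1 - u" using uv by simp
    ultimately show "u *\<^sub>R x + v *\<^sub>R y \<in> {x \<in> {a..b}. g x \<le> c}"
      using r_convex_on_le_max[OF g, of x y u] xy uv by fastforce
  qed
  then have "g \<in> borel_measurable (restrict_space borel {a..b})"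
    by (intro borel_measurable_quasiconvex) (auto simp: is_interval_convex_1)
  then have "(\<lambda>x. indicator {a..b} x *\<^sub>R g x) \<in> borel_measurable lborel"
    by (simp add: borel_measurable_restrict_space_iff)
  then have meas: "(\<lambda>x. indicator {a..b} x *\<^sub>R g x) \<in> borel_measurable lebesgue"
    by (rule measurable_completion)
  have bound: "norm (g z) \<le> max (g a) (g b)" if "z \<in> {a..b}" for z
  proof -
    have "g z > 0" using g that by (simp add: r_convex_on_def)
    moreover have "g z \<le> max (g a) (g b)"
      using r_convex_on_le_max[OF g, of a b "(b - z) / (b - a)"]
        convex_combination_Icc[OF assms(1) that] assms(1) by simp
    ultimately show ?thesis by simp
  qed
  show ?thesis
    unfolding set_integrable_def
    by (rule integrableI_bounded_set[where A = "{a..b}" and B = "max (g a) (g b)"])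
       (use meas bound in \<open>auto simp: emeasure_lborel_Icc_eq\<close>)
qed

theorem theorem7:
  fixes r a b :: real and f g :: "real \<Rightarrow> real"
  assumes "0 \<le> a" and "a < b"
    and "\<And>x. x \<in> {a..b} \<Longrightarrow> 0 < g x"
    and "r_convex_on r a b g"
    and "\<And>x. x \<in> {a..b} \<Longrightarrow> 0 < f x"
    and "convex_dominated_on g r a b f"
    and "set_integrable lebesgue {a..b} f"
  shows "\<bar>log_mean r (f a) (f b) - 1 / (b - a) * (LINT x:{a..b}|lebesgue. f x)\<bar>
           \<le> log_mean r (g a) (g b) - 1 / (b - a) * (LINT x:{a..b}|lebesgue. g x)"
proof -
  define M where "M h z = power_mean r (h a) (h b) ((b - z) / (b - a))" for h :: "real \<Rightarrow> real" and z
  \<comment> \<open>For both functions, the Jensen gap integrates to \<open>b - a\<close> times the difference of the two means.\<close>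
  have gap: "((\<lambda>z. M h z - h z) has_integral
      (b - a) * log_mean r (h a) (h b) - (LINT x:{a..b}|lebesgue. h x)) {a..b}"
    if h: "set_integrable lebesgue {a..b} h" and pos: "\<And>x. x \<in> {a..b} \<Longrightarrow> 0 < h x" for h
    unfolding M_def
    using has_integral_diff[OF has_integral_power_mean_Icc has_integral_set_lebesgue[OF h]]
      pos[of a] pos[of b] \<open>a < b\<close> by simp
  \<comment> \<open>Domination for the pair of end points, with the weight that represents \<open>z\<close>.\<close>
  have "norm (M f z - f z) \<le> M g z - g z" if "z \<in> {a..b}" for z
    using \<open>convex_dominated_on g r a b f\<close> convex_combination_Icc[OF \<open>a < b\<close> that] \<open>a < b\<close>
    unfolding convex_dominated_on_def M_def real_norm_def
    by (metis atLeastAtMost_iff less_imp_le order_refl)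
  then have "\<bar>(b - a) * log_mean r (f a) (f b) - (LINT x:{a..b}|lebesgue. f x)\<bar>
      \<le> (b - a) * log_mean r (g a) (g b) - (LINT x:{a..b}|lebesgue. g x)"
    using integral_norm_bound_integral gap[of f] gap[of g] assms r_convex_on_set_integrable
    by (metis (no_types, lifting) has_integral_integrable integral_unique real_norm_def)
  then have "\<bar>(b - a) * log_mean r (f a) (f b) - (LINT x:{a..b}|lebesgue. f x)\<bar> / (b - a)
      \<le> ((b - a) * log_mean r (g a) (g b) - (LINT x:{a..b}|lebesgue. g x)) / (b - a)"
    using \<open>a < b\<close> by (intro divide_right_mono) auto
  moreover have "(b - a) * p - q = (b - a) * (p - 1 / (b - a) * q)" for p q
    using \<open>a < b\<close> by (simp add: field_simps)
  ultimately show ?thesis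
    using \<open>a < b\<close> by (simp add: abs_mult)
qed

end
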